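(* $f_{3,4}(n) = O\big(n^{3/5}(\ln n)^{1/5}\big)$ as $n\to\infty$.
   Context: For a graph $G$, let $f_3(G)$ be the maximum size of a subset of the vertices of $G$ that spans no triangle. Let $f_{3,4}(n)=\min_G f_3(G)$, where the minimum is over all $K_4$-free graphs $G$ on $n$ vertices. *)

theory Defs
  imports Complex_Main "HOL-Library.Ramsey" "HOL-Library.Landau_Symbols"
begin

text \<open>A finite simple graph is given by its vertex set \<open>V\<close> and its edge set \<open>E \<subseteq> nsets V 2\<close>,
  the edges being two-element sets of vertices; \<^const>\<open>clique\<close> is the predicate of
  HOL-Library.Ramsey.\<close>

definition simple_graph :: "'a set \<Rightarrow> 'a set set \<Rightarrow> bool" where
  "simple_graph V E \<longleftrightarrow> finite V \<and> E \<subseteq> nsets V 2"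

definition clique_free :: "nat \<Rightarrow> 'a set \<Rightarrow> 'a set set \<Rightarrow> bool" where
  "clique_free r S E \<longleftrightarrow> \<not> (\<exists>T \<in> nsets S r. clique T E)"

definition f3 :: "'a set \<Rightarrow> 'a set set \<Rightarrow> nat" where
  "f3 V E = Max {card W | W. W \<subseteq> V \<and> clique_free 3 W E}"

text \<open>Up to isomorphism the vertex set of a graph on \<open>n\<close> vertices may be taken to be \<open>{..<n}\<close>;
  see \<open>f34_le\<close> and \<open>f34_attained\<close> below.\<close>

definition f34 :: "nat \<Rightarrow> nat" where
  "f34 n = Min {f3 {..<n} E | E. simple_graph {..<n} E \<and> clique_free 4 {..<n} E}"

lemma f3_set_finite: "finite V \<Longrightarrow> finite {card W | W. W \<subseteq> V \<and> clique_free 3 W E}"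
  by (rule finite_subset[of _ "card ` Pow V"]) auto

lemma f3_set_nonempty: "{card W | W. W \<subseteq> V \<and> clique_free 3 W E} \<noteq> {}"
  by (auto simp: clique_free_def nsets_def intro!: exI[of _ "{}"])

lemma f34_set_finite:
  "finite {f3 {..<n::nat} E | E. simple_graph {..<n} E \<and> clique_free 4 {..<n} E}"
  by (rule finite_subset[of _ "f3 {..<n} ` Pow (nsets {..<n} 2)"])
     (auto simp: simple_graph_def intro!: finite_imageI finite_imp_finite_nsets)

lemma clique_free_no_edges: "r \<ge> 2 \<Longrightarrow> clique_free r V {}"
proof (unfold clique_free_def, rule notI, elim bexE)
  fix T assume r: "r \<ge> 2" and T: "T \<in> nsets V r" "clique T {}"
  then have "finite T" "\<not> card T \<le> Suc 0" by (auto simp: nsets_def)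
  with T(2) show False by (auto simp: clique_def card_le_Suc0_iff_eq)
qed

lemma f34_set_nonempty:
  "{f3 {..<n::nat} E | E. simple_graph {..<n} E \<and> clique_free 4 {..<n} E} \<noteq> {}"
  using clique_free_no_edges[of 4 "{..<n}"] by (auto simp: simple_graph_def intro!: exI[of _ "{}"])

lemma f34_attained:
  "\<exists>E. simple_graph {..<n} E \<and> clique_free 4 {..<n} E \<and> f3 {..<n} E = f34 n"
  using Min_in[OF f34_set_finite[of n] f34_set_nonempty[of n]] by (force simp: f34_def)

lemma clique_image_iff:
  assumes "inj_on h V" "E \<subseteq> nsets V 2" "T \<subseteq> V"
  shows "clique (h ` T) ((`) h ` E) \<longleftrightarrow> clique T E"
proof -
  have "{h v, h w} \<in> (`) h ` E \<longleftrightarrow> {v, w} \<in> E" if "v \<in> T" "w \<in> T" for v w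
  proof
    assume "{h v, h w} \<in> (`) h ` E"
    then obtain e where e: "e \<in> E" "h ` {v, w} = h ` e" by auto
    then have "e \<subseteq> V" "{v, w} \<subseteq> V" using assms that by (auto simp: nsets_def)
    then have "{v, w} = e" using inj_on_image_eq_iff[OF assms(1)] e(2) by blast
    then show "{v, w} \<in> E" using e(1) by simp
  qed (force intro: rev_image_eqI)
  moreover have "h v = h w \<longleftrightarrow> v = w" if "v \<in> T" "w \<in> T" for v w
    using that assms by (auto dest: inj_onD)
  ultimately show ?thesis by (auto simp: clique_def)
qed

lemma clique_free_image_iff:
  assumes "inj_on h V" "E \<subseteq> nsets V 2" "S \<subseteq> V"
  shows "clique_free r (h ` S) ((`) h ` E) \<longleftrightarrow> clique_free r S E"
proof -
  have inj: "inj_on h S" using assms inj_on_subset by blast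
  have "nsets (h ` S) r = (`) h ` nsets S r"
  proof
    show "nsets (h ` S) r \<subseteq> (`) h ` nsets S r"
    proof
      fix N assume "N \<in> nsets (h ` S) r"
      then have N: "N \<subseteq> h ` S" "finite N" "card N = r" by (auto simp: nsets_def)
      then obtain T where T: "T \<subseteq> S" "N = h ` T" by (auto simp: subset_image_iff)
      then have "inj_on h T" using inj inj_on_subset by blast
      with N T have "T \<in> nsets S r" by (auto simp: nsets_def card_image finite_image_iff)
      with T show "N \<in> (`) h ` nsets S r" by blast
    qed
    show "(`) h ` nsets S r \<subseteq> nsets (h ` S) r"
      using inj by (auto simp: nsets_def intro!: card_image intro: inj_on_subset)
  qed
  moreover have "clique (h ` T) ((`) h ` E) \<longleftrightarrow> clique T E" if "T \<in> nsets S r" for T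
    using clique_image_iff[OF assms(1,2)] that assms(3) by (auto simp: nsets_def)
  ultimately show ?thesis by (simp add: clique_free_def)
qed

lemma f3_image:
  assumes "inj_on h V" "E \<subseteq> nsets V 2"
  shows "f3 (h ` V) ((`) h ` E) = f3 V E"
proof -
  have "{card W | W. W \<subseteq> h ` V \<and> clique_free 3 W ((`) h ` E)}
      = {card (h ` W) | W. W \<subseteq> V \<and> clique_free 3 (h ` W) ((`) h ` E)}"
    by (auto simp: subset_image_iff)
  also have "\<dots> = {card W | W. W \<subseteq> V \<and> clique_free 3 W E}"
    using clique_free_image_iff[OF assms] card_image[OF inj_on_subset[OF assms(1)]]
    by (intro Collect_cong) metis
  finally show ?thesis by (simp add: f3_def)
qed

lemma f34_le:
  assumes "simple_graph V E" "card V = n" "clique_free 4 V E"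
  shows "f34 n \<le> f3 V E"
proof -
  have V: "finite V" "E \<subseteq> nsets V 2" using assms(1) by (auto simp: simple_graph_def)
  obtain h where h: "bij_betw h V {..<n}"
    using ex_bij_betw_finite_nat[OF V(1)] assms(2) by (auto simp: atLeast0LessThan)
  then have inj: "inj_on h V" and im: "h ` V = {..<n}" by (auto simp: bij_betw_def)
  have "(`) h ` E \<subseteq> nsets {..<n} 2"
  proof
    fix x assume "x \<in> (`) h ` E"
    then obtain e where e: "e \<in> E" "x = h ` e" by blast
    then have "e \<subseteq> V" "finite e" "card e = 2" using V(2) by (auto simp: nsets_def)
    then show "x \<in> nsets {..<n} 2"
      using e(2) im card_image[OF inj_on_subset[OF inj]] by (auto simp: nsets_def)
  qed
  then have "simple_graph {..<n} ((`) h ` E)" by (simp add: simple_graph_def)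
  moreover have "clique_free 4 {..<n} ((`) h ` E)"
    using clique_free_image_iff[OF inj V(2), of V 4] assms(3) im by simp
  moreover have "f3 {..<n} ((`) h ` E) = f3 V E" using f3_image[OF inj V(2)] im by simp
  ultimately show ?thesis
    unfolding f34_def by (intro Min_le[OF f34_set_finite]) force
qed

end

theory Submission
  imports Defs "HOL-Computational_Algebra.Primes" "HOL-Real_Asymp.Real_Asymp"
begin

text \<open>
  Let \<open>p\<close> be an odd prime, \<open>c\<close> a nonsquare mod \<open>p\<close> and \<open>f(x, y) = x\<^sup>2 - c y\<^sup>2\<close>, an anisotropic form.
  The vertices are the \<open>p\<^sup>5\<close> affine lines of the 4-space over the field with \<open>p\<close> elements whose
  direction is \<open>(1, x, y, f(x, y))\<close>; these directions form a cap, so three lines that meet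
  pairwise are concurrent (this is the affine part of the generalized quadrangle \<open>T\<^sub>3(O)\<close>). At each
  point the lines through it are coloured at random with three colours, and two lines are adjacent
  if they meet in a point where their colours differ. A clique is concurrent and rainbow, so there is no
  \<open>K\<^sub>4\<close>. There are \<open>p\<^sup>4\<close> points with \<open>p\<^sup>2\<close> lines through each, and a set of \<open>6 p\<^sup>3\<close> lines has \<open>6 p\<^sup>4\<close>
  incidences; a union bound over these sets and over the choice of a missing colour at every point
  shows that with positive probability each set has a point where all three colours occur, that
  is, a triangle. This gives a triangle-free number of order \<open>n\<^bsup>3/5\<^esup>\<close>, even without the
  logarithm. A prime of the right order of magnitude exists by Chebyshev's argument.
\<close>

section \<open>Chebyshev's argument: a prime between 2^(2j-3) and 2^(2j)\<close>

text \<open>The numbers 1/((n+1) C(n,k)) form Leibniz's harmonic triangle: each is a difference of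
  two with smaller k, so multiplying by \<open>Q\<close> makes all of them integers once it does so
  on the border k = 0. This is used to bound common multiples of 1, ..., M from below.\<close>

lemma Suc_mult_binomial_dvd:
  assumes "k \<le> n" and "\<And>i. 0 < i \<Longrightarrow> i \<le> Suc n \<Longrightarrow> i dvd Q"
  shows "Suc n * (n choose k) dvd (Q::nat)"
  using assms
proof (induction k arbitrary: n)
  case 0
  then show ?case by auto
next
  case (Suc k)
  then obtain n' where n: "n = Suc n'" by (cases n) auto
  define a b c where "a = real (Suc n * (n choose k))" and "b = real (n * (n' choose k))"
    and "c = real (Suc n * (n choose Suc k))"
  have pos: "a > 0" "b > 0" "c > 0" using Suc.prems(1) n
    by (simp_all only: a_def b_def c_def of_nat_0_less_iff nat_0_less_mult_iff zero_less_binomial_iff) auto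
  have ints: "real Q / a \<in> \<int>" "real Q / b \<in> \<int>"
  proof -
    have "Suc n * (n choose k) dvd Q" using Suc by simp
    then show "real Q / a \<in> \<int>" unfolding a_def by (auto elim!: dvdE)
    have "Suc n' * (n' choose k) dvd Q" using Suc.prems n by (intro Suc.IH) auto
    then show "real Q / b \<in> \<int>" unfolding b_def n by (auto elim!: dvdE)
  qed
  define d where "d = n' - k"
  have d: "n' = k + d" using Suc.prems(1) n by (simp add: d_def)
  \<comment> \<open>the recurrence of Leibniz's harmonic triangle\<close>
  have "1 / c = 1 / b - 1 / a"
  proof -
    have B: "real (n' choose k) = fact n' / (fact k * fact d)"
      using d by (simp add: binomial_fact)
    have C: "real (n choose k) = (real k + real d + 1) * fact n' / (fact k * ((real d + 1) * fact d))"
      using binomial_fact[of k n, where 'a = real] d n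
      by (simp del: binomial_Suc_Suc add: Suc_diff_le algebra_simps)
    have D: "real (n choose Suc k) = (real k + real d + 1) * fact n' / ((real k + 1) * fact k * fact d)"
      using binomial_fact[of "Suc k" n, where 'a = real] d n
      by (simp del: binomial_Suc_Suc add: algebra_simps)
    have "real n = real k + real d + 1" using d n by simp
    moreover have "real k + 1 \<noteq> 0" "real d + 1 \<noteq> 0" "real k + real d + 1 \<noteq> 0"
      "real k + real d + 2 \<noteq> 0" "real k + (real d + 2) \<noteq> 0" by linarith+
    ultimately show ?thesis
      unfolding a_def b_def c_def of_nat_mult B C D
      by (simp add: divide_simps) (simp add: algebra_simps)
  qed
  then have "real Q / c = real Q / b - real Q / a"
    by (metis mult.right_neutral right_diff_distrib times_divide_eq_right)
  then have "real Q / c \<in> \<int>" using ints by simp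
  then obtain z where "real Q / c = of_int z" by (auto elim: Ints_cases)
  then have "real Q = of_int z * c" using pos by (simp add: field_simps)
  then have "int Q = z * int (Suc n * (n choose Suc k))"
    unfolding c_def by (metis of_int_eq_iff of_int_mult of_int_of_nat_eq)
  then have "int (Suc n * (n choose Suc k)) dvd int Q" by simp
  then show ?case by (simp only: int_dvd_int_iff)
qed

lemma prod_primes_dvd:
  fixes x :: nat
  assumes "finite A" "\<And>p. p \<in> A \<Longrightarrow> prime p" "\<And>p. p \<in> A \<Longrightarrow> p dvd x"
  shows "\<Prod>A dvd x"
  using assms
proof (induction A rule: finite_induct)
  case (insert p A)
  then have "coprime p (\<Prod>A)" by (intro prod_coprime_right primes_coprime) auto
  then show ?case using insert by (simp add: divides_mult)
qed simp

text \<open>A prime in (N, 2N] divides (2N)! but not N!, hence divides C(2N, N), which is at most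
  4^N.\<close>

lemma prod_primes_le_4_power: "\<Prod>{p. prime p \<and> N < p \<and> p \<le> 2 * N} \<le> (4::nat) ^ N"
proof -
  have "\<Prod>{p. prime p \<and> N < p \<and> p \<le> 2 * N} dvd (2 * N choose N)"
  proof (rule prod_primes_dvd)
    fix p assume "p \<in> {p. prime p \<and> N < p \<and> p \<le> 2 * N}"
    then have p: "prime p" "N < p" "p \<le> 2 * N" by auto
    have "fact (2 * N) = fact N * fact N * (2 * N choose N)"
      using binomial_fact_lemma[of N "2 * N"] by simp
    then have "p dvd fact N * fact N * (2 * N choose N)"
      using p prime_dvd_fact_iff[of p "2 * N"] by simp
    then show "p dvd (2 * N choose N)"
      using p by (simp add: prime_dvd_mult_iff prime_dvd_fact_iff)
  qed auto
  then have "\<Prod>{p. prime p \<and> N < p \<and> p \<le> 2 * N} \<le> (2 * N choose N)"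
    by (intro dvd_imp_le) auto
  also have "\<dots> \<le> 2 ^ (2 * N)" by (rule binomial_le_pow2)
  finally show ?thesis by (simp add: power_mult)
qed

text \<open>Doubling the range from N to 2N multiplies the primorial by at most 4^N, exactly the
  factor that turns 4^N into 4^(2N).\<close>

lemma primorial_power_2_le: "\<Prod>{p. prime p \<and> p \<le> 2 ^ k} \<le> (4::nat) ^ (2 ^ k)"
proof (induction k)
  case 0
  have "{p::nat. prime p \<and> p \<le> 2 ^ 0} = {}" by (auto dest: prime_gt_1_nat)
  then show ?case by (simp only: prod.empty) simp
next
  case (Suc k)
  define N :: nat where "N = 2 ^ k"
  let ?A = "{p. prime p \<and> p \<le> N}" and ?B = "{p. prime p \<and> N < p \<and> p \<le> 2 * N}"
  have "{p. prime p \<and> p \<le> 2 ^ Suc k} = ?A \<union> ?B" by (auto simp: N_def)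
  then have "\<Prod>{p. prime p \<and> p \<le> 2 ^ Suc k} = \<Prod>?A * \<Prod>?B"
    by (simp add: prod.union_disjoint[of ?A ?B] disjoint_iff)
  also have "\<dots> \<le> 4 ^ N * 4 ^ N"
    using Suc prod_primes_le_4_power[of N] unfolding N_def by (rule mult_le_mono)
  also have "\<dots> = 4 ^ 2 ^ Suc k" by (simp add: N_def flip: power_add mult_2)
  finally show ?case .
qed

text \<open>\<open>Q\<close> is the least common multiple of 1, ..., M. Each prime power in it is at
  most M, which bounds the contribution of the at most S primes up to S; a prime above S occurs only
  to the first power because its square exceeds M.\<close>

lemma common_multiple_le:
  fixes M :: nat
  assumes M: "M > 0" and noprime: "\<And>p. prime p \<Longrightarrow> p \<le> M \<Longrightarrow> p \<le> N" and S: "M \<le> S\<^sup>2"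
  obtains Q :: nat where "Q > 0" "\<And>i. 0 < i \<Longrightarrow> i \<le> M \<Longrightarrow> i dvd Q"
    "Q \<le> M ^ S * \<Prod>{p. prime p \<and> p \<le> N}"
proof -
  define P where "P = {p::nat. prime p \<and> p \<le> M}"
  define e where "e p = Max ((\<lambda>i. multiplicity p i) ` {1..M})" for p :: nat
  define Q where "Q = (\<Prod>p\<in>P. p ^ e p)"
  have finP: "finite P" by (auto simp: P_def)
  have e_le: "multiplicity p i \<le> e p" if "0 < i" "i \<le> M" for p i
    unfolding e_def using that by (intro Max_ge) auto
  have pe: "p ^ e p \<le> M" for p
  proof -
    have "e p \<in> (\<lambda>i. multiplicity p i) ` {1..M}" unfolding e_def using M by (intro Max_in) auto
    then obtain i where i: "i \<in> {1..M}" "e p = multiplicity p i" by auto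
    have "p ^ multiplicity p i \<le> i" using i by (intro dvd_imp_le multiplicity_dvd) auto
    then show ?thesis using i by auto
  qed
  have pos: "Q > 0" unfolding Q_def P_def by (auto intro!: prod_pos dest: prime_gt_0_nat)
  have dvd: "i dvd Q" if i: "0 < i" "i \<le> M" for i
  proof (rule multiplicity_le_imp_dvd)
    fix p :: nat assume p: "prime p"
    show "multiplicity p i \<le> multiplicity p Q"
    proof (cases "p \<in> P")
      case True
      then have "p ^ e p dvd Q" unfolding Q_def using finP by (intro dvd_prodI)
      then have "e p \<le> multiplicity p Q" using pos p by (intro multiplicity_geI) auto
      then show ?thesis using e_le[OF i] le_trans by blast
    next
      case False
      then have "\<not> p dvd i" using p i by (auto simp: P_def dest: dvd_imp_le)
      then show ?thesis by (simp add: not_dvd_imp_multiplicity_0)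
    qed
  qed (use i in auto)
  let ?small = "{p \<in> P. p \<le> S}" and ?large = "{p \<in> P. S < p}"
  have "Q = (\<Prod>p\<in>?small. p ^ e p) * (\<Prod>p\<in>?large. p ^ e p)"
    unfolding Q_def using finP by (subst prod.union_disjoint[symmetric]) (auto intro!: prod.cong)
  also have "(\<Prod>p\<in>?small. p ^ e p) \<le> M ^ S"
  proof -
    have "(\<Prod>p\<in>?small. p ^ e p) \<le> (\<Prod>p\<in>?small. M)" using pe by (intro prod_mono) auto
    also have "\<dots> = M ^ card ?small" by simp
    also have "card ?small \<le> card {1..S}" by (intro card_mono) (auto simp: P_def dest: prime_gt_0_nat)
    then have "M ^ card ?small \<le> M ^ S" using M by (intro power_increasing) auto
    finally show ?thesis .
  qed
  also have "(\<Prod>p\<in>?large. p ^ e p) \<le> \<Prod>?large"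
  proof (rule prod_mono, safe)
    fix p assume "p \<in> P" "S < p"
    have "e p \<le> 1"
    proof (rule ccontr)
      assume "\<not> e p \<le> 1"
      then have "p ^ 2 \<le> p ^ e p" using \<open>S < p\<close> by (intro power_increasing) auto
      moreover have "S\<^sup>2 < p ^ 2" using \<open>S < p\<close> by (intro power_strict_mono) auto
      ultimately show False using pe[of p] S by linarith
    qed
    then show "p ^ e p \<le> p" using power_increasing[of "e p" 1 p] \<open>S < p\<close> by auto
  qed
  also have "\<Prod>?large \<le> \<Prod>{p. prime p \<and> p \<le> N}"
    using noprime by (intro dvd_imp_le prod_dvd_prod_subset prod_pos)
      (auto simp: P_def dest: prime_gt_0_nat)
  finally show ?thesis using that pos dvd by simp
qed

text \<open>With M = 8N and no prime in (N, M], the least common multiple of 1, ..., M would be at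
  most M^sqrt(M) * 4^N, whereas a multiple of (2n+1) C(2n, n) with n = 4N - 1 is at least
  4^(4N-1).\<close>

lemma exists_prime_between_powers_2:
  assumes "j \<ge> 6"
  obtains p :: nat where "prime p" "2 ^ (2 * j - 3) < p" "p \<le> 2 ^ (2 * j)"
proof -
  define M N where "M = (2::nat) ^ (2 * j)" and "N = (2::nat) ^ (2 * j - 3)"
  obtain i where i: "j = i + 6" using assms by (metis le_add_diff_inverse2)
  have "2 * j = 3 + (2 * j - 3)" using i by simp
  then have "M = 2 ^ 3 * N" unfolding M_def N_def by (metis power_add)
  then have MN: "M = 8 * N" by simp
  have "2 * j - 3 = 3 + i + j" using i by simp
  then have "N = 2 ^ 3 * 2 ^ i * 2 ^ j" unfolding N_def by (metis power_add)
  then have N: "N = 8 * 2 ^ i * 2 ^ j" by simp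
  have "\<exists>p. prime p \<and> N < p \<and> p \<le> M"
  proof (rule ccontr)
    assume "\<not> ?thesis"
    then have noprime: "\<And>p. prime p \<Longrightarrow> p \<le> M \<Longrightarrow> p \<le> N" by (meson not_le)
    \<comment> \<open>The exponent of M is even so that its square root \<open>2 ^ j\<close> is an
      integer.\<close>
    have square: "M \<le> (2 ^ j)\<^sup>2" by (simp add: M_def mult.commute flip: power_mult)
    have pos: "M > 0" by (simp add: M_def)
    obtain Q where Q: "Q > 0" "\<And>i. 0 < i \<Longrightarrow> i \<le> M \<Longrightarrow> i dvd Q"
        "Q \<le> M ^ 2 ^ j * \<Prod>{p. prime p \<and> p \<le> N}"
      by (rule common_multiple_le[OF pos noprime square]) blast+
    \<comment> \<open>The largest n with 2n + 1 \<le> M, so that the harmonic triangle applies to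
      \<open>Q\<close>.\<close>
    define n where "n = 4 * N - 1"
    have M: "M = 2 * n + 2" and n: "n > 0"
      using MN pos by (auto simp: n_def)
    have le_Q: "Suc (2 * n) * (2 * n choose n) \<le> Q"
      using Suc_mult_binomial_dvd[of n "2 * n" Q] Q M by (intro dvd_imp_le) auto
    have "real (4 ^ n) \<le> real (2 * n * (2 * n choose n))"
      using central_binomial_lower_bound[OF n] n by (simp add: field_simps)
    then have "4 ^ n \<le> 2 * n * (2 * n choose n)" by (simp only: of_nat_le_iff)
    also have "\<dots> \<le> Suc (2 * n) * (2 * n choose n)" by (intro mult_le_mono1) simp
    also note le_Q
    also note Q(3)
    also have "M ^ 2 ^ j * \<Prod>{p. prime p \<and> p \<le> N} \<le> M ^ 2 ^ j * 4 ^ N"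
      unfolding N_def by (intro mult_le_mono2 primorial_power_2_le)
    also have "M ^ 2 ^ j = 2 ^ (2 * j * 2 ^ j)"
      by (simp only: M_def power_mult)
    also have "(4::nat) ^ N = 2 ^ (2 * N)"
      by (simp add: power_mult)
    also have "(4::nat) ^ n = 2 ^ (2 * n)"
      by (simp add: power_mult)
    finally have "(2::nat) ^ (2 * n) \<le> 2 ^ (2 * j * 2 ^ j + 2 * N)"
      by (simp only: power_add)
    then have "2 * n \<le> 2 * j * 2 ^ j + 2 * N"
      by (rule power_le_imp_le_exp[rotated]) simp
    then have "6 * N \<le> 2 * j * 2 ^ j + 2" using M MN by linarith
    then have "24 * 2 ^ i * 2 ^ j \<le> j * 2 ^ j + 1" by (simp add: N)
    \<comment> \<open>Here j \<ge> 6 enters through j = i + 6; the two estimates together would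
      force 2^j \<le> 1.\<close>
    moreover have "j + 1 \<le> 24 * 2 ^ i" unfolding i using less_exp[of i] by linarith
    then have "(j + 1) * 2 ^ j \<le> 24 * 2 ^ i * 2 ^ j" by (rule mult_le_mono1)
    moreover have "(2::nat) ^ j > 1" using assms by (intro one_less_power) auto
    ultimately show False by (simp add: algebra_simps)
  qed
  then show ?thesis using that unfolding M_def N_def by blast
qed

section \<open>The random colouring, as a counting argument\<close>

text \<open>Read \<open>g t v\<close> as the position of the line v at parameter t, so that the
  points are the pairs in \<open>T \<times> A\<close>, and \<open>\<chi> t v\<close> as the colour
  of v at its point with parameter t. If W fails, every point misses a colour on W. Fixing W and
  these missing colours leaves 2 instead of 3 choices at each of the m |T| incidences of W;
  \<open>less\<close> is the resulting union bound.\<close>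

lemma exists_rainbow_colouring:
  fixes g :: "'t \<Rightarrow> 'v \<Rightarrow> 'a"
  assumes fin: "finite V" "finite T" "finite A"
    and g: "\<And>t v. t \<in> T \<Longrightarrow> v \<in> V \<Longrightarrow> g t v \<in> A"
    and less: "(card V choose m) * 3 ^ (card T * card A) * 2 ^ (m * card T) < (3::nat) ^ (m * card T)"
  obtains \<chi> :: "'t \<Rightarrow> 'v \<Rightarrow> nat"
  where "\<And>t v. t \<in> T \<Longrightarrow> v \<in> V \<Longrightarrow> \<chi> t v < 3"
    and "\<And>W. W \<subseteq> V \<Longrightarrow> card W = m \<Longrightarrow>
      \<exists>t\<in>T. \<exists>a\<in>A. \<forall>c<3. \<exists>w\<in>W. g t w = a \<and> \<chi> t w = c"
proof -
  define \<Omega> where "\<Omega> = (T \<times> V \<rightarrow>\<^sub>E {..<3::nat})"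
  define H where "H = (T \<times> A \<rightarrow>\<^sub>E {..<3::nat})"
  define \<W> where "\<W> = {W. W \<subseteq> V \<and> card W = m}"
  \<comment> \<open>The colourings in which, at every point, no line of W through it receives the
    colour that h forbids there.\<close>
  define B where "B = (\<lambda>(W, h). \<Pi>\<^sub>E (t, v) \<in> T \<times> V.
    if v \<in> W then {..<3::nat} - {h (t, g t v)} else {..<3})"
  have finW: "finite \<W>" and cardW: "card \<W> = card V choose m"
    using fin by (auto simp: \<W>_def n_subsets)
  have finH: "finite H" and cardH: "card H = 3 ^ (card T * card A)"
    using fin by (auto simp: H_def card_PiE card_cartesian_product intro!: finite_PiE)
  have cardO: "card \<Omega> = 3 ^ (card T * card V)"
    using fin by (auto simp: \<Omega>_def card_PiE card_cartesian_product)
  have cardB: "card (B (W, h)) = 2 ^ (m * card T) * 3 ^ (card T * (card V - m))"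
    if "W \<in> \<W>" "h \<in> H" for W h
  proof -
    have W: "W \<subseteq> V" "card W = m" "finite W"
      using that fin by (auto simp: \<W>_def intro: finite_subset)
    have h: "h (t, g t v) < 3" if "t \<in> T" "v \<in> V" for t v
      using that g \<open>h \<in> H\<close> by (auto simp: H_def PiE_iff)
    have "card (B (W, h)) = (\<Prod>(t, v)\<in>T \<times> V. if v \<in> W then 2 else 3)"
      unfolding B_def prod.case using fin h by (subst card_PiE) (auto intro!: prod.cong)
    also have "\<dots> = (\<Prod>t\<in>T. \<Prod>v\<in>V. if v \<in> W then 2 else 3)"
      by (rule prod.cartesian_product[symmetric])
    also have "(\<Prod>v\<in>V. if v \<in> W then 2 else 3 :: nat) = 2 ^ m * 3 ^ (card V - m)"
    proof -
      have "V = W \<union> (V - W)" using W by auto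
      then have "(\<Prod>v\<in>V. if v \<in> W then 2 else 3 :: nat)
          = (\<Prod>v\<in>W. if v \<in> W then 2 else 3) * (\<Prod>v\<in>V - W. if v \<in> W then 2 else 3)"
        using prod.union_disjoint[of W "V - W" "\<lambda>v. if v \<in> W then 2 else 3 :: nat"] W fin by auto
      then show ?thesis using W by (simp add: card_Diff_subset)
    qed
    finally show ?thesis by (simp add: power_mult_distrib flip: power_mult)
  qed
  have "\<exists>\<chi>\<in>\<Omega>. \<chi> \<notin> (\<Union>x \<in> \<W> \<times> H. B x)"
  proof (cases "m \<le> card V")
    case True
    have "card (\<Union>x \<in> \<W> \<times> H. B x) \<le> (\<Sum>x \<in> \<W> \<times> H. card (B x))"
      using finW finH by (intro card_UN_le) auto
    also have "\<dots> = (card V choose m) * 3 ^ (card T * card A)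
        * (2 ^ (m * card T) * 3 ^ (card T * (card V - m)))"
      using cardB by (subst sum.cong[OF refl, of _ _ "\<lambda>_. 2 ^ (m * card T) * 3 ^ (card T * (card V - m))"])
        (auto simp: card_cartesian_product cardW cardH)
    \<comment> \<open>The incidences outside W are free and contribute the same factor to both sides
      of \<open>less\<close>.\<close>
    also have "\<dots> < 3 ^ (m * card T) * 3 ^ (card T * (card V - m))"
      using less by (simp flip: mult.assoc)
    also have "\<dots> = 3 ^ (card T * card V)"
      using True by (simp add: diff_mult_distrib2 mult.commute flip: power_add)
    finally have *: "card (\<Union>x \<in> \<W> \<times> H. B x) < card \<Omega>" by (simp add: cardO)
    have "finite (\<Union>x \<in> \<W> \<times> H. B x)"
      using finW finH fin by (auto simp: B_def intro!: finite_PiE split: if_splits)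
    then show ?thesis
      using * card_mono by (metis subsetI leD)
  next
    \<comment> \<open>With no m-subset at all, any colouring will do; the case is separate because
      \<open>card V - m\<close> is truncated.\<close>
    case False
    then have "\<W> = {}" using fin card_mono by (fastforce simp: \<W>_def)
    moreover have "\<Omega> \<noteq> {}" by (auto simp: \<Omega>_def PiE_eq_empty_iff lessThan_empty_iff)
    ultimately show ?thesis by auto
  qed
  then obtain \<chi> where \<chi>: "\<chi> \<in> \<Omega>" "\<And>W h. W \<in> \<W> \<Longrightarrow> h \<in> H \<Longrightarrow> \<chi> \<notin> B (W, h)" by blast
  show ?thesis
  proof (rule that[of "\<lambda>t v. \<chi> (t, v)"])
    show "\<chi> (t, v) < 3" if "t \<in> T" "v \<in> V" for t v
      using \<chi>(1) that by (auto simp: \<Omega>_def PiE_iff)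
  next
    fix W assume W: "W \<subseteq> V" "card W = m"
    show "\<exists>t\<in>T. \<exists>a\<in>A. \<forall>c<3. \<exists>w\<in>W. g t w = a \<and> \<chi> (t, w) = c"
    proof (rule ccontr)
      assume "\<not> ?thesis"
      then have "\<forall>q\<in>T \<times> A. \<exists>c<3. \<forall>w\<in>W. g (fst q) w = snd q \<longrightarrow> \<chi> (fst q, w) \<noteq> c"
        by fastforce
      then obtain k where k: "\<forall>q\<in>T \<times> A. k q < 3 \<and>
          (\<forall>w\<in>W. g (fst q) w = snd q \<longrightarrow> \<chi> (fst q, w) \<noteq> k q)"
        by metis
      define h where "h = restrict k (T \<times> A)"
      have "h \<in> H" using k by (auto simp: H_def h_def)
      moreover have "\<chi> \<in> B (W, h)"
        using \<chi>(1) k g W(1) by (fastforce simp: B_def \<Omega>_def PiE_iff h_def split: if_splits)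
      ultimately show False using \<chi>(2)[of W h] W by (simp add: \<W>_def)
    qed
  qed
qed

section \<open>From concurrent lines and colours to a graph\<close>

lemma not_clique_free_3I:
  assumes "a \<in> W" "b \<in> W" "c \<in> W" "a \<noteq> b" "a \<noteq> c" "b \<noteq> c"
    and "{a, b} \<in> E" "{a, c} \<in> E" "{b, c} \<in> E"
  shows "\<not> clique_free 3 W E"
proof -
  have "{a, b, c} \<in> nsets W 3" using assms by (auto simp: nsets_def)
  moreover have "clique {a, b, c} E"
    using assms by (auto simp: clique_def insert_commute)
  ultimately show ?thesis by (auto simp: clique_free_def)
qed

text \<open>Triangle-freeness passes to subsets, so testing sets of size exactly m suffices, as in
  the union bound.\<close>

lemma f3_le:
  assumes "finite V" and "\<And>W. W \<subseteq> V \<Longrightarrow> card W = m \<Longrightarrow> \<not> clique_free 3 W E"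
  shows "f3 V E \<le> m"
  unfolding f3_def
proof (rule Max.boundedI[OF f3_set_finite[OF assms(1)] f3_set_nonempty], clarify)
  fix W assume W: "W \<subseteq> V" "clique_free 3 W E"
  show "card W \<le> m"
  proof (rule ccontr)
    assume "\<not> card W \<le> m"
    then obtain U where U: "U \<subseteq> W" "card U = m"
      by (metis nat_le_linear obtain_subset_with_card_n)
    then have "clique_free 3 U E"
      using W(2) nsets_mono[of U W 3] by (auto simp: clique_free_def)
    then show False using assms(2)[of U] U W(1) by auto
  qed
qed

text \<open>The geometry enters only through \<open>concurrent\<close>: three distinct lines that
  meet pairwise do so at one parameter. Four pairwise adjacent lines then share a point and need
  four colours there, while a point with all three colours on W gives a triangle in W.\<close>

lemma f34_le_concurrent:
  fixes g :: "'t \<Rightarrow> 'v \<Rightarrow> 'a"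
  assumes fin: "finite V" "finite T" "finite A"
    and g: "\<And>t v. t \<in> T \<Longrightarrow> v \<in> V \<Longrightarrow> g t v \<in> A"
    and concurrent: "\<And>r s t u v w. \<lbrakk>r \<in> T; s \<in> T; t \<in> T; u \<in> V; v \<in> V; w \<in> V;
        u \<noteq> v; v \<noteq> w; u \<noteq> w; g r u = g r v; g s v = g s w; g t u = g t w\<rbrakk> \<Longrightarrow> r = s \<and> s = t"
    and less: "(card V choose m) * 3 ^ (card T * card A) * 2 ^ (m * card T) < (3::nat) ^ (m * card T)"
  shows "f34 (card V) \<le> m"
proof -
  obtain \<chi> :: "'t \<Rightarrow> 'v \<Rightarrow> nat"
    where \<chi>: "\<And>t v. t \<in> T \<Longrightarrow> v \<in> V \<Longrightarrow> \<chi> t v < 3"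
      and rainbow: "\<And>W. W \<subseteq> V \<Longrightarrow> card W = m \<Longrightarrow>
        \<exists>t\<in>T. \<exists>a\<in>A. \<forall>c<3. \<exists>w\<in>W. g t w = a \<and> \<chi> t w = c"
    by (rule exists_rainbow_colouring[OF fin _ less, of g]) (use g in blast)+
  define E where "E = {{v, w} | v w. v \<in> V \<and> w \<in> V \<and> (\<exists>t\<in>T. g t v = g t w \<and> \<chi> t v \<noteq> \<chi> t w)}"
  have E_iff: "{v, w} \<in> E \<longleftrightarrow> v \<in> V \<and> w \<in> V \<and> (\<exists>t\<in>T. g t v = g t w \<and> \<chi> t v \<noteq> \<chi> t w)" for v w
    unfolding E_def by (auto simp: doubleton_eq_iff) metis+
  have simple: "simple_graph V E"
    using fin(1) by (auto simp: simple_graph_def E_def nsets_def card_insert_if)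
  have K4: "clique_free 4 V E"
    unfolding clique_free_def
  proof clarify
    fix S assume S: "S \<in> nsets V 4" "clique S E"
    then obtain a b c d where abcd: "S = {a, b, c, d}" and distinct: "distinct [a, b, c, d]"
      by (auto simp: nsets_def numeral_eq_Suc card_Suc_eq)
    have V: "a \<in> V" "b \<in> V" "c \<in> V" "d \<in> V" using S(1) abcd by (auto simp: nsets_def)
    have "{a, b} \<in> E" "{a, c} \<in> E" "{a, d} \<in> E" "{b, c} \<in> E" "{b, d} \<in> E" "{c, d} \<in> E"
      using S(2) distinct by (auto simp: clique_def abcd)
    then obtain ab ac ad bc bd cd
      where T: "ab \<in> T" "ac \<in> T" "ad \<in> T" "bc \<in> T" "bd \<in> T" "cd \<in> T"
      and eq: "g ab a = g ab b" "g ac a = g ac c" "g ad a = g ad d"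
         "g bc b = g bc c" "g bd b = g bd d" "g cd c = g cd d"
      and neq: "\<chi> ab a \<noteq> \<chi> ab b" "\<chi> ac a \<noteq> \<chi> ac c" "\<chi> ad a \<noteq> \<chi> ad d"
         "\<chi> bc b \<noteq> \<chi> bc c" "\<chi> bd b \<noteq> \<chi> bd d" "\<chi> cd c \<noteq> \<chi> cd d"
      unfolding E_iff by metis
    \<comment> \<open>The triangles abc, abd and acd cover all six pairs and are linked by ab and
      ac, so all six meeting parameters agree.\<close>
    have "ab = bc \<and> bc = ac"
      using concurrent[of ab bc ac a b c] T V eq distinct by auto
    moreover have "ab = bd \<and> bd = ad"
      using concurrent[of ab bd ad a b d] T V eq distinct by auto
    moreover have "ac = cd \<and> cd = ad"
      using concurrent[of ac cd ad a c d] T V eq distinct by auto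
    ultimately have "ac = ab" "ad = ab" "bc = ab" "bd = ab" "cd = ab" by metis+
    then have "\<chi> ab a \<noteq> \<chi> ab b" "\<chi> ab a \<noteq> \<chi> ab c" "\<chi> ab a \<noteq> \<chi> ab d"
        "\<chi> ab b \<noteq> \<chi> ab c" "\<chi> ab b \<noteq> \<chi> ab d" "\<chi> ab c \<noteq> \<chi> ab d"
      using neq by simp_all
    then have "card (\<chi> ab ` S) = 4" by (auto simp: abcd)
    moreover have "\<chi> ab ` S \<subseteq> {..<3}" using \<chi> T(1) V by (auto simp: abcd)
    ultimately show False using card_mono[of "{..<3::nat}" "\<chi> ab ` S"] by simp
  qed
  have "f3 V E \<le> m"
  proof (rule f3_le[OF fin(1)])
    fix W assume W: "W \<subseteq> V" "card W = m"
    then obtain t a where t: "t \<in> T" and "\<forall>c<3. \<exists>w\<in>W. g t w = a \<and> \<chi> t w = c"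
      using rainbow by blast
    then obtain w where w: "\<And>c. c < 3 \<Longrightarrow> w c \<in> W \<and> g t (w c) = a \<and> \<chi> t (w c) = c"
      by metis
    have neq: "w i \<noteq> w j" if "i < 3" "j < 3" "i \<noteq> j" for i j
      using w[of i] w[of j] that by metis
    have edge: "{w i, w j} \<in> E" if "i < 3" "j < 3" "i \<noteq> j" for i j
      unfolding E_iff using w[of i] w[of j] that t W(1) by (metis subsetD)
    show "\<not> clique_free 3 W E"
      by (rule not_clique_free_3I[of "w 0" W "w 1" "w 2"]) (simp_all add: w edge neq)
  qed
  then show ?thesis
    using f34_le[OF simple refl K4] by simp
qed

section \<open>The anisotropic form and the cap of directions\<close>

text \<open>Squaring on the residues identifies 1 with p - 1, so it is not injective and, on a
  finite set, not surjective.\<close>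

lemma exists_nonsquare_mod_prime:
  assumes p: "prime (p::int)" "p > 2"
  obtains c where "\<And>x. \<not> p dvd x\<^sup>2 - c"
proof -
  let ?sq = "\<lambda>x. x\<^sup>2 mod p"
  have "\<not> inj_on ?sq {0..<p}"
  proof
    assume "inj_on ?sq {0..<p}"
    moreover have "?sq 1 = ?sq (p - 1)"
      unfolding mod_eq_dvd_iff by (rule dvdI[of _ _ "2 - p"]) (simp add: power2_eq_square algebra_simps)
    ultimately have "1 = p - 1" by (rule inj_onD) (use p(2) in auto)
    then show False using p(2) by simp
  qed
  then have "?sq ` {0..<p} \<noteq> {0..<p}"
    using finite_surj_inj[of "{0..<p}" ?sq] by auto
  moreover have "?sq ` {0..<p} \<subseteq> {0..<p}" using p by auto
  ultimately obtain c where c: "c \<in> {0..<p}" "c \<notin> ?sq ` {0..<p}" by blast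
  have "\<not> p dvd x\<^sup>2 - c" for x
  proof
    assume "p dvd x\<^sup>2 - c"
    then have "?sq (x mod p) = c" using c(1) by (simp add: power_mod flip: mod_eq_dvd_iff)
    moreover have "x mod p \<in> {0..<p}" using p by auto
    ultimately show False using c(2) by blast
  qed
  then show ?thesis by (rule that)
qed

text \<open>If y had an inverse z mod p, then (x z)^2 would be congruent to the nonsquare c.\<close>

lemma norm_form_anisotropic:
  assumes p: "prime (p::int)" and c: "\<And>x. \<not> p dvd x\<^sup>2 - c"
    and dvd: "p dvd x\<^sup>2 - c * y\<^sup>2"
  shows "p dvd x \<and> p dvd y"
proof -
  have "p dvd y"
  proof (rule ccontr)
    assume "\<not> p dvd y"
    then have "coprime y p" using p by (metis coprime_commute prime_imp_coprime)
    then obtain z w where zw: "y * z + p * w = 1"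
      using bezout_int[of y p] by (auto simp: mult.commute)
    have "(x * z)\<^sup>2 - c = (x\<^sup>2 - c * y\<^sup>2) * z\<^sup>2 + c * ((y * z)\<^sup>2 - 1)"
      by (simp add: algebra_simps power2_eq_square)
    also have "(y * z)\<^sup>2 - 1 = p * (- w * (y * z + 1))"
    proof -
      have "(y * z)\<^sup>2 - 1 = (y * z - 1) * (y * z + 1)" by (simp add: algebra_simps power2_eq_square)
      also have "y * z - 1 = - (p * w)" using zw by simp
      finally show ?thesis by simp
    qed
    finally have "p dvd (x * z)\<^sup>2 - c" using dvd by simp
    then show False using c by blast
  qed
  then have "p dvd x\<^sup>2" using dvd by (metis dvd_diffD1 dvd_mult power2_eq_square dvd_diff_commute dvd_diff_right_iff)
  then show ?thesis using p \<open>p dvd y\<close> prime_dvd_power by blast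
qed

lemma concurrent_mod_prime:
  fixes p c :: int
  defines "f \<equiv> \<lambda>x y. x\<^sup>2 - c * y\<^sup>2"
  assumes p: "prime p" and c: "\<And>x. \<not> p dvd x\<^sup>2 - c"
    and x: "p dvd (u1 - u2) + r * (x1 - x2)" "p dvd (u2 - u3) + s * (x2 - x3)" "p dvd (u1 - u3) + t * (x1 - x3)"
    and y: "p dvd (v1 - v2) + r * (y1 - y2)" "p dvd (v2 - v3) + s * (y2 - y3)" "p dvd (v1 - v3) + t * (y1 - y3)"
    and f: "p dvd (w1 - w2) + r * (f x1 y1 - f x2 y2)" "p dvd (w2 - w3) + s * (f x2 y2 - f x3 y3)"
      "p dvd (w1 - w3) + t * (f x1 y1 - f x3 y3)"
    and neq: "\<not> (p dvd x1 - x2 \<and> p dvd y1 - y2)" "\<not> (p dvd x2 - x3 \<and> p dvd y2 - y3)"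
      "\<not> (p dvd x1 - x3 \<and> p dvd y1 - y3)"
  shows "p dvd r - s \<and> p dvd s - t"
proof -
  define a b where "a = r - t" and "b = s - r"
  define X Y X' Y' where "X = x1 - x3" and "Y = y1 - y3" and "X' = x2 - x3" and "Y' = y2 - y3"
  note defs = a_def b_def X_def Y_def X'_def Y'_def
  have X: "p dvd a * X + b * X'"
    using dvd_diff[OF dvd_add[OF x(1,2)] x(3)] by (simp add: defs algebra_simps)
  have Y: "p dvd a * Y + b * Y'"
    using dvd_diff[OF dvd_add[OF y(1,2)] y(3)] by (simp add: defs algebra_simps)
  have F: "p dvd a * (f x1 y1 - f x3 y3) + b * (f x2 y2 - f x3 y3)"
    using dvd_diff[OF dvd_add[OF f(1,2)] f(3)] by (simp add: defs algebra_simps)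
  \<comment> \<open>Expanding f around (x3, y3): the terms linear in the differences cancel by
    \<open>X\<close> and \<open>Y\<close>, and only the quadratic part remains.\<close>
  have "a * f X Y + b * f X' Y' = a * (f x1 y1 - f x3 y3) + b * (f x2 y2 - f x3 y3)
      - 2 * x3 * (a * X + b * X') + 2 * c * y3 * (a * Y + b * Y')"
    by (simp add: defs f_def algebra_simps power2_eq_square)
  then have N: "p dvd a * f X Y + b * f X' Y'"
    using X Y F by (simp only: dvd_add dvd_diff dvd_mult)
  \<comment> \<open>modulo \<open>p\<close>, \<open>(b X', b Y') = - (a X, a Y)\<close>, so that \<open>b\<^sup>2 f X' Y' = a\<^sup>2 f X Y\<close>\<close>
  have "a * (a + b) * f X Y = b * (a * f X Y + b * f X' Y')
      - (b * X' - a * X) * (a * X + b * X') + c * (b * Y' - a * Y) * (a * Y + b * Y')"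
    by (simp add: f_def algebra_simps power2_eq_square)
  then have "p dvd a * (a + b) * f X Y"
    using X Y N by (simp only: dvd_add dvd_diff dvd_mult)
  \<comment> \<open>Each factor uses up one of the assumptions that the directions differ: a the
    pair 2, 3; a + b = s - t the pair 1, 2; f X Y, by anisotropy, the pair 1, 3.\<close>
  then consider "p dvd a" | "p dvd a + b" | "p dvd f X Y"
    using p by (auto simp: prime_dvd_mult_iff)
  then have "p dvd a \<and> p dvd b"
  proof cases
    case 1
    then have "p dvd b * X'" "p dvd b * Y'"
      using X Y by (simp_all add: dvd_add_right_iff)
    then show ?thesis using 1 neq(2) p by (auto simp: prime_dvd_mult_iff X'_def Y'_def)
  next
    case 2
    have "a * (x1 - x2) = (a * X + b * X') - (a + b) * X'" "a * (y1 - y2) = (a * Y + b * Y') - (a + b) * Y'"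
      by (simp_all add: X_def X'_def Y_def Y'_def algebra_simps)
    then have "p dvd a * (x1 - x2)" "p dvd a * (y1 - y2)"
      using X Y 2 by (simp_all only: dvd_diff dvd_mult2)
    then have "p dvd a" using neq(1) p by (auto simp: prime_dvd_mult_iff)
    then show ?thesis using 2 by (simp add: dvd_add_right_iff)
  next
    case 3
    then show ?thesis
      using norm_form_anisotropic[OF p c, of X Y] neq(3) by (simp add: f_def X_def Y_def)
  qed
  then have "p dvd - b" "p dvd a + b" by auto
  then show ?thesis by (simp add: a_def b_def)
qed

section \<open>The graph on the lines of the 4-space mod p\<close>

text \<open>The tuple (x, y, u, v, w) encodes the line through (0, u, v, w) with direction (1, x, y,
  f x y), and \<open>g t\<close> gives its last three coordinates where the first is t.
  \<open>large\<close> is the p^3-th root of the union bound for m = 6 p^3, with 192 = 3 * 2^6 and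
  729 = 3^6; the factor 6 is ample, as (3/2)^6 > 3.\<close>

lemma f34_le_prime:
  assumes p: "prime p" "p > 2" and n: "n \<le> p ^ 5" and large: "p ^ 30 * 192 ^ p < 729 ^ p"
  shows "f34 n \<le> 6 * p ^ 3"
proof -
  define q where "q = int p"
  have q: "prime q" "q > 2" using p by (auto simp: q_def)
  obtain c where c: "\<And>x. \<not> q dvd x\<^sup>2 - c"
    using exists_nonsquare_mod_prime[OF q] by blast
  define T where "T = {0..<q}"
  define f where "f x y = x\<^sup>2 - c * y\<^sup>2" for x y
  define g where "g = (\<lambda>t (x, y, u, v, w).
    ((u + t * x) mod q, (v + t * y) mod q, (w + t * f x y) mod q))"
  have T: "finite T" "card T = p" by (auto simp: T_def q_def)
  have "card (T \<times> T \<times> T) = p ^ 3" "card (T \<times> T \<times> T \<times> T \<times> T) = p ^ 5"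
    by (simp_all add: card_cartesian_product T numeral_eq_Suc)
  then obtain V where V: "V \<subseteq> T \<times> T \<times> T \<times> T \<times> T" "card V = n" "finite V"
    using obtain_subset_with_card_n[of n "T \<times> T \<times> T \<times> T \<times> T"] n by metis
  \<comment> \<open>Coordinates are reduced residues, so congruence mod q is equality.\<close>
  have cong: "q dvd a - b \<longleftrightarrow> a = b" if "a \<in> T" "b \<in> T" for a b
    using that by (simp add: T_def flip: mod_eq_dvd_iff)
  have meet: "q dvd (u - u') + t * (x - x')" "q dvd (v - v') + t * (y - y')"
      "q dvd (w - w') + t * (f x y - f x' y')"
    if "g t (x, y, u, v, w) = g t (x', y', u', v', w')" for t x y u v w x' y' u' v' w'
    using that by (auto simp: g_def mod_eq_dvd_iff algebra_simps)
  \<comment> \<open>Distinct parallel lines do not meet.\<close>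
  have direction: "\<not> (q dvd x - x' \<and> q dvd y - y')"
    if "(x, y, u, v, w) \<in> V" "(x', y', u', v', w') \<in> V" "(x, y, u, v, w) \<noteq> (x', y', u', v', w')"
      "g t (x, y, u, v, w) = g t (x', y', u', v', w')" for t x y u v w x' y' u' v' w'
  proof
    assume "q dvd x - x' \<and> q dvd y - y'"
    then have xy: "x = x'" "y = y'" using that(1,2) V(1) cong by auto
    then have "q dvd u - u'" "q dvd v - v'" "q dvd w - w'" using meet[OF that(4)] by auto
    then have "u = u'" "v = v'" "w = w'" using that(1,2) V(1) cong by auto
    then show False using that(3) xy by simp
  qed
  have "f34 (card V) \<le> 6 * p ^ 3"
  proof (rule f34_le_concurrent[of V T "T \<times> T \<times> T" g])
    show "g t v \<in> T \<times> T \<times> T" for t v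
      using q by (auto simp: g_def T_def split: prod.split)
  next
    fix r s t and i j k :: "int \<times> int \<times> int \<times> int \<times> int"
    assume rst: "r \<in> T" "s \<in> T" "t \<in> T" and ijk: "i \<in> V" "j \<in> V" "k \<in> V" "i \<noteq> j" "j \<noteq> k" "i \<noteq> k"
      and g: "g r i = g r j" "g s j = g s k" "g t i = g t k"
    obtain x1 y1 u1 v1 w1 where i: "i = (x1, y1, u1, v1, w1)" by (rule prod_cases5)
    obtain x2 y2 u2 v2 w2 where j: "j = (x2, y2, u2, v2, w2)" by (rule prod_cases5)
    obtain x3 y3 u3 v3 w3 where k: "k = (x3, y3, u3, v3, w3)" by (rule prod_cases5)
    note ijk = ijk[unfolded i j k] and g = g[unfolded i j k]
    have "q dvd r - s \<and> q dvd s - t"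
      by (rule concurrent_mod_prime[OF q(1) c meet(1)[OF g(1)] meet(1)[OF g(2)] meet(1)[OF g(3)]
            meet(2)[OF g(1)] meet(2)[OF g(2)] meet(2)[OF g(3)]
            meet(3)[OF g(1), unfolded f_def] meet(3)[OF g(2), unfolded f_def] meet(3)[OF g(3), unfolded f_def]
            direction[OF ijk(1,2,4) g(1)] direction[OF ijk(2,3,5) g(2)] direction[OF ijk(1,3,6) g(3)]])
    then show "r = s \<and> s = t" using rst cong by blast
  next
    have "(n choose (6 * p ^ 3)) \<le> (p ^ 5) ^ (6 * p ^ 3)"
    proof (cases "6 * p ^ 3 \<le> n")
      case True
      then show ?thesis using binomial_le_pow power_mono[OF n] le_trans by blast
    qed (simp add: binomial_eq_0)
    also have "\<dots> = (p ^ 30) ^ p ^ 3" by (simp flip: power_mult)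
    finally have "(n choose (6 * p ^ 3)) * 3 ^ (p * p ^ 3) * 2 ^ (6 * p ^ 3 * p)
        \<le> (p ^ 30) ^ p ^ 3 * (3 ^ p) ^ p ^ 3 * (64 ^ p) ^ p ^ 3"
    proof (intro mult_le_mono)
      have "(2::nat) ^ (6 * p ^ 3 * p) = (2 ^ 6) ^ (p * p ^ 3)"
        by (simp only: mult_ac flip: power_mult)
      then show "(2::nat) ^ (6 * p ^ 3 * p) \<le> (64 ^ p) ^ p ^ 3" by (simp add: power_mult)
    qed (simp_all add: power_mult)
    also have "\<dots> = (p ^ 30 * 192 ^ p) ^ p ^ 3"
    proof -
      have "(192::nat) ^ p = 3 ^ p * 64 ^ p" by (simp flip: power_mult_distrib)
      then show ?thesis by (simp add: power_mult_distrib)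
    qed
    also have "\<dots> < (729 ^ p) ^ p ^ 3"
      using large p by (intro power_strict_mono) auto
    also have "\<dots> = (3 ^ 6) ^ (p * p ^ 3)" by (simp add: power_mult)
    also have "\<dots> = 3 ^ (6 * p ^ 3 * p)" by (simp only: mult_ac flip: power_mult)
    finally show "(card V choose (6 * p ^ 3)) * 3 ^ (card T * card (T \<times> T \<times> T)) * 2 ^ (6 * p ^ 3 * card T)
        < 3 ^ (6 * p ^ 3 * card T)"
      using V(2) T(2) \<open>card (T \<times> T \<times> T) = p ^ 3\<close> by simp
  qed (use V T in auto)
  then show ?thesis using V(2) by simp
qed

section \<open>Choice of the prime and asymptotics\<close>

lemma eventually_power_30_192_less_729: "eventually (\<lambda>p::nat. p ^ 30 * 192 ^ p < 729 ^ p) at_top"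
proof -
  have "eventually (\<lambda>p::nat. real p ^ 30 * 192 ^ p < 729 ^ p) at_top" by real_asymp
  then show ?thesis
    by eventually_elim (simp flip: of_nat_less_iff[where 'a = real])
qed

theorem theorem1p2:
  shows "(\<lambda>n. real (f34 n)) \<in> O(\<lambda>n. real n powr (3/5) * ln (real n) powr (1/5))"
proof -
  obtain P where P: "\<And>p::nat. p \<ge> P \<Longrightarrow> p ^ 30 * 192 ^ p < 729 ^ p"
    using eventually_power_30_192_less_729 by (auto simp: eventually_at_top_linorder)
  \<comment> \<open>Beyond \<open>J\<close> both the existence of a prime (j \<ge> 6) and the
    inequality for p \<ge> P are available.\<close>
  define J where "J = max 6 P"
  \<comment> \<open>The 6 comes from 6 p^3. The upper end for p^5 is 2^(10j), while minimality of j
    gives n > 2^(10j-25); hence p^5 \<le> 2^25 n.\<close>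
  define C :: real where "C = 6 * (2 ^ 25) powr (3/5)"
  have bound: "real (f34 n) \<le> C * real n powr (3/5)" if n: "n > 2 ^ (5 * (2 * J - 3))" for n
  proof -
    \<comment> \<open>The least j for which every p > 2^(2j-3) satisfies n \<le> p^5; the next lines
      show that j = n + 3 is a candidate.\<close>
    define j where "j = (LEAST j. n \<le> 2 ^ (5 * (2 * j - 3)))"
    have "n \<le> 2 ^ n" using less_exp[of n] by simp
    also have "(2::nat) ^ n \<le> 2 ^ (5 * (2 * (n + 3) - 3))" by (intro power_increasing) auto
    finally have n_le: "n \<le> 2 ^ (5 * (2 * j - 3))" unfolding j_def by (rule LeastI)
    have "J < j"
    proof (rule ccontr)
      assume "\<not> J < j"
      then have "(2::nat) ^ (5 * (2 * j - 3)) \<le> 2 ^ (5 * (2 * J - 3))" by (intro power_increasing) auto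
      then show False using n n_le by linarith
    qed
    then have j: "j > 6" "j > P" by (auto simp: J_def)
    have "\<not> n \<le> 2 ^ (5 * (2 * (j - 1) - 3))"
      unfolding j_def by (rule not_less_Least) (use j in \<open>simp flip: j_def\<close>)
    then have n_ge: "2 ^ (5 * (2 * (j - 1) - 3)) < n" by simp
    obtain p :: nat where p: "prime p" "2 ^ (2 * j - 3) < p" "p \<le> 2 ^ (2 * j)"
      using exists_prime_between_powers_2[of j] j by auto
    have "P < 2 ^ (2 * j - 3)" using less_exp[of "2 * j - 3"] j by linarith
    then have "p > 2" "p \<ge> P" using p(2) less_exp[of "2 * j - 3"] j by linarith+
    have "n \<le> (2 ^ (2 * j - 3)) ^ 5" using n_le by (simp add: mult.commute flip: power_mult)
    also have "\<dots> \<le> p ^ 5" using p(2) by (intro power_mono) auto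
    finally have f34: "f34 n \<le> 6 * p ^ 3" using f34_le_prime p(1) \<open>p > 2\<close> P[OF \<open>p \<ge> P\<close>] by blast
    have "p ^ 5 \<le> (2 ^ (2 * j)) ^ 5" using p(3) by (intro power_mono) auto
    also have "\<dots> = 2 ^ (25 + 5 * (2 * (j - 1) - 3))"
    proof -
      have "2 * j * 5 = 25 + 5 * (2 * (j - 1) - 3)" using j by simp
      then show ?thesis by (metis power_mult)
    qed
    also have "\<dots> \<le> 2 ^ 25 * n" using n_ge by (simp add: power_add)
    finally have "real (p ^ 5) \<le> real (2 ^ 25 * n)" by (simp only: of_nat_le_iff)
    then have p5: "real p ^ 5 \<le> 2 ^ 25 * real n" by simp
    have "real p > 0" using \<open>p > 2\<close> by simp
    then have "real p ^ 3 = (real p ^ 5) powr (3/5)"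
      using powr_powr[of "real p" 5 "3/5"] by (simp add: powr_numeral)
    also have "\<dots> \<le> (2 ^ 25 * real n) powr (3/5)" using p5 by (intro powr_mono2) auto
    also have "\<dots> = (2 ^ 25) powr (3/5) * real n powr (3/5)" by (simp add: powr_mult)
    finally have "6 * real p ^ 3 \<le> C * real n powr (3/5)" by (simp add: C_def)
    moreover have "real (f34 n) \<le> 6 * real p ^ 3"
      using of_nat_mono[OF f34, where 'a = real] by simp
    ultimately show ?thesis by linarith
  qed
  have "(\<lambda>n. real (f34 n)) \<in> O(\<lambda>n. real n powr (3/5))"
  proof (rule bigoI)
    show "\<forall>\<^sub>F n in at_top. norm (real (f34 n)) \<le> C * norm (real n powr (3/5))"
      using eventually_gt_at_top by eventually_elim (use bound in simp)
  qed
  \<comment> \<open>The factor (ln n)^(1/5) tends to infinity, so it only enlarges the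
    bound.\<close>
  also have "(\<lambda>n::nat. real n powr (3/5)) \<in> O(\<lambda>n. real n powr (3/5) * ln (real n) powr (1/5))"
    by real_asymp
  finally show ?thesis .
qed

end
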